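(* Let $p\in(0,1)$ and $s\in(1,\infty)$. For every $\bar u\in L^s(\Omega)$, \[ \widehat{\partial} q_{s,p}(\bar u)=\{\eta\in L^r(\Omega) : \eta=p\,|\bar u|^{p-2}\bar u \text{ a.e. on } \{\bar u\neq 0\}\}. \] In particular, the set on the right-hand side is empty if $|\bar u|^{p-1}\chi_{\{\bar u\neq 0\}}\notin L^r(\Omega)$.
   Context: $\Omega\subset\mathbb{R}^d$ is a Lebesgue-measurable set with positive and finite Lebesgue measure. For $s\in(1,\infty)$, $r\in(1,\infty)$ is given by $\frac1s+\frac1r=1$, and $L^r(\Omega)$ is identified with the dual of $L^s(\Omega)$. For measurable $u$, $\{u\neq0\}:=\{x\in\Omega : u(x)\neq 0\}$ (defined up to null sets); $\chi_A$ denotes the characteristic function of $A\subset\Omega$, and $|\bar u|^{p-1}\chi_{\{\bar u\neq 0\}}$ is understood as $0$ outside $\{\bar u\ne 0\}$. For $p\in(0,1)$ the functional $q_{s,p}\colon L^s(\Omega)\to\mathbb{R}$ is $q_{s,p}(u):=\int_\Omega |u(x)|^p\,\mathrm{d}x$. The Fréchet subdifferential of $q_{s,p}$ at $\bar u\in L^s(\Omega)$ is \[ \widehat{\partial} q_{s,p}(\bar u):=\Bigl\{\eta\in L^r(\Omega) : \liminf_{\Vert h\Vert_s\searrow 0}\frac{q_{s,p}(\bar u+h)-q_{s,p}(\bar u)-\int_\Omega\eta(x)h(x)\,\mathrm{d}x}{\Vert h\Vert_s}\ge 0\Bigr\}, \] where the lower limit is over $h\in L^s(\Omega)\setminus\{0\}$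 with $\Vert h\Vert_s\to 0$. *)

theory Defs
  imports "HOL-Analysis.Analysis"
begin

text \<open>
  Elements of \<open>L\<^sup>s(\<Omega>)\<close> are represented by functions, not by classes of a.e. equal functions.
  Membership and all notions below depend only on the values in \<open>\<Omega>\<close> up to null sets,
  and the zero element of \<open>L\<^sup>s(\<Omega>)\<close> is the set of functions vanishing a.e. on \<open>\<Omega>\<close>.
\<close>

definition Lebesgue_space :: "'a::euclidean_space set \<Rightarrow> real \<Rightarrow> ('a \<Rightarrow> real) set" where
  "Lebesgue_space \<Omega> s =
    {u \<in> borel_measurable (lebesgue_on \<Omega>). integrable (lebesgue_on \<Omega>) (\<lambda>x. \<bar>u x\<bar> powr s)}"

definition Lebesgue_norm :: "'a::euclidean_space set \<Rightarrow> real \<Rightarrow> ('a \<Rightarrow> real) \<Rightarrow> real" where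
  "Lebesgue_norm \<Omega> s u = (\<integral>x. \<bar>u x\<bar> powr s \<partial>lebesgue_on \<Omega>) powr (1 / s)"

definition nonzero_to_zero :: "'a::euclidean_space set \<Rightarrow> real \<Rightarrow> ('a \<Rightarrow> real) filter" where
  "nonzero_to_zero \<Omega> s =
    inf (filtercomap (Lebesgue_norm \<Omega> s) (nhds 0))
        (principal (Lebesgue_space \<Omega> s - {h. AE x in lebesgue_on \<Omega>. h x = 0}))"

text \<open>
  In the following definition \<open>r\<close> is meant to be the exponent conjugate to \<open>s\<close>, so that
  \<open>\<eta> \<in> L\<^sup>r(\<Omega>)\<close> acts on \<open>L\<^sup>s(\<Omega>)\<close> by integration. The lower limit is taken in the extended reals.
\<close>

definition frechet_subdifferential ::
  "'a::euclidean_space set \<Rightarrow> real \<Rightarrow> real \<Rightarrow> (('a \<Rightarrow> real) \<Rightarrow> real) \<Rightarrow> ('a \<Rightarrow> real) \<Rightarrow> ('a \<Rightarrow> real) set"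
where
  "frechet_subdifferential \<Omega> s r f u =
    {\<eta> \<in> Lebesgue_space \<Omega> r.
      0 \<le> Liminf (nonzero_to_zero \<Omega> s)
            (\<lambda>h. ereal ((f (\<lambda>x. u x + h x) - f u - (\<integral>x. \<eta> x * h x \<partial>lebesgue_on \<Omega>))
                         / Lebesgue_norm \<Omega> s h))}"

text \<open>
  The functional \<open>q\<^bsub>s,p\<^esub>\<close>; the exponent \<open>s\<close> only determines its domain \<open>L\<^sup>s(\<Omega>)\<close>. The integral is
  finite there for \<open>0 < p < 1 < s\<close> and \<open>\<Omega>\<close> of finite measure. Note that \<open>0 powr p = 0\<close>.
\<close>

definition q_functional :: "'a::euclidean_space set \<Rightarrow> real \<Rightarrow> ('a \<Rightarrow> real) \<Rightarrow> real" where
  "q_functional \<Omega> p u = (\<integral>x. \<bar>u x\<bar> powr p \<partial>lebesgue_on \<Omega>)"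

end

theory Submission imports Defs
begin

text \<open>
  For \<open>\<eta>\<close> in the right-hand set, the negative part of
  \<open>(\<bar>u + h\<bar> powr p - \<bar>u\<bar> powr p - \<eta> * h) / \<bar>h\<bar>\<close> is dominated by a multiple of \<open>\<bar>\<eta>\<bar>\<close> and tends
  to \<open>0\<close> pointwise as \<open>h \<rightarrow> 0\<close>: where \<open>u \<noteq> 0\<close> by differentiability, and where \<open>u = 0\<close> because
  \<open>\<bar>h\<bar> powr p\<close> beats every linear function near \<open>0\<close>. If \<open>h \<rightarrow> 0\<close> in \<open>L\<^sup>s\<close>, then almost everywhere
  along a subsequence, so that by dominated convergence the negative part tends to \<open>0\<close> in \<open>L\<^sup>r\<close>, and
  Hoelder's inequality bounds the difference quotient from below.

  Conversely, a subgradient \<open>\<eta>\<close> is tested with \<open>w / n\<close>, where \<open>w\<close> is the sign of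
  \<open>\<eta> - p * \<bar>u\<bar> powr (p - 2) * u\<close> cut off to \<open>{\<bar>u\<bar> > c}\<close>. There the functional has a directional
  derivative, and the sign of the limit forces \<open>w = 0\<close> almost everywhere.
\<close>

section \<open>Hoelder's inequality\<close>

lemma Holder_inequality:
  fixes f g :: "'a \<Rightarrow> real"
  assumes pq: "1 < p" "1 < q" "1 / p + 1 / q = 1"
    and f: "f \<in> borel_measurable M" "integrable M (\<lambda>x. \<bar>f x\<bar> powr p)"
    and g: "g \<in> borel_measurable M" "integrable M (\<lambda>x. \<bar>g x\<bar> powr q)"
  shows "integrable M (\<lambda>x. f x * g x)" (is ?int)
    and "(\<integral>x. \<bar>f x * g x\<bar> \<partial>M) \<le>
      (\<integral>x. \<bar>f x\<bar> powr p \<partial>M) powr (1 / p) * (\<integral>x. \<bar>g x\<bar> powr q \<partial>M) powr (1 / q)" (is ?le)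
proof -
  note [measurable] = f(1) g(1)
  have Young: "\<bar>a * b\<bar> \<le> \<bar>a\<bar> powr p / p + \<bar>b\<bar> powr q / q" for a b :: real
    using Youngs_inequality[of p q "\<bar>a\<bar>" "\<bar>b\<bar>"] pq by (simp add: abs_mult)
  show int: ?int
    by (rule Bochner_Integration.integrable_bound
        [where f = "\<lambda>x. \<bar>f x\<bar> powr p / p + \<bar>g x\<bar> powr q / q"])
      (use f g Young pq in \<open>auto intro!: AE_I2 order_trans[OF Young]\<close>)
  define A where "A = (\<integral>x. \<bar>f x\<bar> powr p \<partial>M) powr (1 / p)"
  define B where "B = (\<integral>x. \<bar>g x\<bar> powr q \<partial>M) powr (1 / q)"
  have AB: "A powr p = (\<integral>x. \<bar>f x\<bar> powr p \<partial>M)" "B powr q = (\<integral>x. \<bar>g x\<bar> powr q \<partial>M)"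
    using pq by (auto simp: A_def B_def powr_powr)
  show ?le
  \<comment> \<open>The normalisation below divides by \<open>A\<close> and \<open>B\<close>. If one
    of them is 0, the corresponding function vanishes almost everywhere and so does the
    product.\<close>
  proof (cases "A = 0 \<or> B = 0")
    case True
    then have "AE x in M. f x * g x = 0"
    proof
      assume "A = 0"
      then have "AE x in M. \<bar>f x\<bar> powr p = 0"
        using AB(1) f(2) pq by (subst integral_nonneg_eq_0_iff_AE[symmetric]) auto
      then show ?thesis by eventually_elim simp
    next
      assume "B = 0"
      then have "AE x in M. \<bar>g x\<bar> powr q = 0"
        using AB(2) g(2) pq by (subst integral_nonneg_eq_0_iff_AE[symmetric]) auto
      then show ?thesis by eventually_elim simp
    qed
    then have "(\<integral>x. \<bar>f x * g x\<bar> \<partial>M) = 0"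
      by (subst integral_cong_AE[where g = "\<lambda>x. 0"]) auto
    then show ?thesis by simp
  next
    case False
    then have pos: "A > 0" "B > 0" by (auto simp: A_def B_def)
    have "(\<integral>x. \<bar>f x * g x\<bar> \<partial>M) / (A * B) = (\<integral>x. \<bar>f x / A * (g x / B)\<bar> \<partial>M)"
      using pos by (simp add: abs_mult)
    \<comment> \<open>Young's inequality for \<open>f x / A\<close> and \<open>g x / B\<close>. By
      the choice of \<open>A\<close> and \<open>B\<close> the two integrals then reduce to
      \<open>1 / p\<close> and \<open>1 / q\<close>.\<close>
    also have "\<dots> \<le> (\<integral>x. \<bar>f x\<bar> powr p / (A powr p * p) + \<bar>g x\<bar> powr q / (B powr q * q) \<partial>M)"
    proof (rule integral_mono)
      show "integrable M (\<lambda>x. \<bar>f x / A * (g x / B)\<bar>)"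
        using integrable_divide[OF integrable_abs[OF int], of "A * B"] pos by (simp add: abs_mult)
      show "integrable M (\<lambda>x. \<bar>f x\<bar> powr p / (A powr p * p) + \<bar>g x\<bar> powr q / (B powr q * q))"
        using f g by auto
      show "\<bar>f x / A * (g x / B)\<bar>
          \<le> \<bar>f x\<bar> powr p / (A powr p * p) + \<bar>g x\<bar> powr q / (B powr q * q)" for x
        using Young[of "f x / A" "g x / B"] pos by (simp add: powr_divide)
    qed
    also have "\<dots> = A powr p / (A powr p * p) + B powr q / (B powr q * q)"
      using f g by (simp add: AB)
    also have "\<dots> = 1" using pos pq by simp
    finally show ?thesis using pos unfolding A_def[symmetric] B_def[symmetric] by (simp add: field_simps)
  qed
qed

section \<open>One-variable estimates for powers of the absolute value\<close>

text \<open>By homogeneity, dividing by |a| leaves |x^p - 1| \<le> |x - 1| for x \<ge> 0, which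
  holds because x^p lies between 1 and x. No smallness of \<open>h\<close> is required, so
  \<open>a + h\<close> may change sign.\<close>

lemma abs_powr_diff_le:
  fixes a h p :: real
  assumes "a \<noteq> 0" "0 \<le> p" "p \<le> 1"
  shows "\<bar>\<bar>a + h\<bar> powr p - \<bar>a\<bar> powr p\<bar> \<le> \<bar>a\<bar> powr (p - 1) * \<bar>h\<bar>"
proof -
  have le: "\<bar>x powr p - 1\<bar> \<le> \<bar>x - 1\<bar>" if "0 \<le> x" for x :: real
  proof (cases "x \<le> 1")
    case True
    then show ?thesis
      using that assms powr_le1[of p x] powr_mono'[of p 1 x] by simp
  next
    case False
    then show ?thesis
      using assms ge_one_powr_ge_zero[of x p] powr_mono[of p 1 x] by simp
  qed
  define x where "x = \<bar>a + h\<bar> / \<bar>a\<bar>"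
  have eq: "\<bar>a + h\<bar> = \<bar>a\<bar> * x" "\<bar>a + h\<bar> powr p = \<bar>a\<bar> powr p * x powr p"
    using assms by (simp_all add: x_def powr_divide)
  have "\<bar>\<bar>a + h\<bar> powr p - \<bar>a\<bar> powr p\<bar> = \<bar>a\<bar> powr p * \<bar>x powr p - 1\<bar>"
    using eq(2) abs_mult[of "\<bar>a\<bar> powr p" "x powr p - 1"] by (simp add: right_diff_distrib)
  also have "\<dots> \<le> \<bar>a\<bar> powr p * \<bar>x - 1\<bar>"
    by (intro mult_left_mono le) (auto simp: x_def)
  also have "\<dots> = \<bar>a\<bar> powr (p - 1) * \<bar>\<bar>a\<bar> * x - \<bar>a\<bar>\<bar>"
    using assms abs_mult[of "\<bar>a\<bar>" "x - 1"] by (simp add: powr_diff right_diff_distrib)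
  also have "\<dots> \<le> \<bar>a\<bar> powr (p - 1) * \<bar>h\<bar>"
    using eq by (intro mult_left_mono) auto
  finally show ?thesis .
qed

text \<open>Chain rule: near a nonzero point the absolute value is the identity or its negative,
  with derivative \<open>sgn a\<close>, and |a|^(p-1) sgn a = |a|^(p-2) a.\<close>

lemma DERIV_abs_powr:
  fixes a p :: real
  assumes "a \<noteq> 0"
  shows "((\<lambda>x. \<bar>x\<bar> powr p) has_real_derivative p * \<bar>a\<bar> powr (p - 2) * a) (at a)"
proof -
  have eq: "\<bar>a\<bar> powr (p - 2) * a = \<bar>a\<bar> powr (p - 1) * sgn a"
    using assms powr_add[of "\<bar>a\<bar>" "p - 2" 1] by (simp add: sgn_real_def)
  have "(abs has_real_derivative sgn a) (at a)"
  proof (cases "0 < a")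
    case True
    then show ?thesis
      by (intro has_field_derivative_transform_within_open[where g = abs,
            OF DERIV_ident[THEN DERIV_cong], of _ "{0<..}"]) auto
  next
    case False
    then show ?thesis using assms
      by (intro has_field_derivative_transform_within_open[where g = abs,
            OF DERIV_minus[OF DERIV_ident, THEN DERIV_cong], of _ "{..<0}"]) auto
  qed
  then show ?thesis
    using assms by (auto intro!: derivative_eq_intros simp: eq mult.assoc)
qed

text \<open>The negative part is kept with its sign, so values are nonpositive, and division by zero
  gives 0 at \<open>h = 0\<close>. Truncation is what permits domination: for a = 0 and p < 1 the
  quotient itself is unbounded above as h tends to 0.\<close>

definition defect :: "real \<Rightarrow> real \<Rightarrow> real \<Rightarrow> real \<Rightarrow> real" where
  "defect p y a h = min 0 ((\<bar>a + h\<bar> powr p - \<bar>a\<bar> powr p - y * h) / \<bar>h\<bar>)"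

lemma measurable_defect [measurable (raw)]:
  assumes [measurable]: "y \<in> borel_measurable M" "u \<in> borel_measurable M" "h \<in> borel_measurable M"
  shows "(\<lambda>x. defect p (y x) (u x) (h x)) \<in> borel_measurable M"
  unfolding defect_def by measurable

lemma defect_mult_le: "defect p y a h * \<bar>h\<bar> \<le> \<bar>a + h\<bar> powr p - \<bar>a\<bar> powr p - y * h"
  by (cases "h = 0") (auto simp: defect_def min_def field_simps)

text \<open>Yields a majorant that does not depend on \<open>h\<close>. For a = 0 the power term is
  nonnegative and only the linear term counts, costing |y|. For nonzero a the factor |a|^(p-1) in
  \<open>abs_powr_diff_le\<close> equals |y| / p, and the linear term adds |y|.\<close>

lemma abs_defect_le:
  assumes p: "0 < p" "p < 1" and y: "a \<noteq> 0 \<Longrightarrow> y = p * \<bar>a\<bar> powr (p - 2) * a"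
  shows "\<bar>defect p y a h\<bar> \<le> (1 / p + 1) * \<bar>y\<bar>"
proof -
  have "\<bar>a + h\<bar> powr p - \<bar>a\<bar> powr p - y * h \<ge> - ((1 / p + 1) * \<bar>y\<bar>) * \<bar>h\<bar>"
  proof (cases "a = 0")
    case True
    have "0 \<le> 1 / p * (\<bar>y\<bar> * \<bar>h\<bar>)" "y * h \<le> \<bar>y\<bar> * \<bar>h\<bar>" "0 \<le> \<bar>y\<bar> * \<bar>h\<bar>" "0 \<le> \<bar>h\<bar> powr p"
      using p by (auto simp: abs_mult[symmetric])
    then have "y * h \<le> \<bar>h\<bar> powr p + (\<bar>y\<bar> * \<bar>h\<bar> + 1 / p * (\<bar>y\<bar> * \<bar>h\<bar>))"
      by linarith
    then show ?thesis using True p by (simp add: algebra_simps)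
  next
    case False
    have "\<bar>y\<bar> = p * \<bar>a\<bar> powr (p - 1)"
      using False p y powr_add[of "\<bar>a\<bar>" "p - 2" 1] by (simp add: abs_mult)
    then have "\<bar>a\<bar> powr (p - 1) = 1 / p * \<bar>y\<bar>" using p by simp
    then have "\<bar>a + h\<bar> powr p - \<bar>a\<bar> powr p \<ge> - (1 / p * \<bar>y\<bar> * \<bar>h\<bar>)"
      using abs_powr_diff_le[OF False, of p h] p by (simp only: abs_le_iff) linarith
    moreover have "y * h \<le> \<bar>y\<bar> * \<bar>h\<bar>" by (simp add: abs_mult[symmetric])
    ultimately show ?thesis by (simp add: algebra_simps)
  qed
  then have "- ((1 / p + 1) * \<bar>y\<bar>) \<le> (\<bar>a + h\<bar> powr p - \<bar>a\<bar> powr p - y * h) / \<bar>h\<bar>" if "h \<noteq> 0"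
    using that by (subst pos_le_divide_eq) auto
  moreover have "0 \<le> (1 / p + 1) * \<bar>y\<bar>" using p by simp
  ultimately show ?thesis
    unfolding defect_def by (cases "h = 0") (simp, linarith)
qed

lemma defect_tendsto_0:
  assumes p: "0 < p" "p < 1" and y: "a \<noteq> 0 \<Longrightarrow> y = p * \<bar>a\<bar> powr (p - 2) * a"
    and h: "(h \<longlongrightarrow> 0) F"
  shows "((\<lambda>n. defect p y a (h n)) \<longlongrightarrow> 0) F"
proof (cases "a = 0")
  case True
  \<comment> \<open>Here |y h| = (|y| |h|^(1-p)) |h|^p. Once the bracket is below 1, the quotient is
    nonnegative and the defect is exactly 0.\<close>
  have "((\<lambda>n. \<bar>y\<bar> * \<bar>h n\<bar> powr (1 - p)) \<longlongrightarrow> 0) F"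
    using p by (auto intro!: tendsto_eq_intros h)
  then have "\<forall>\<^sub>F n in F. \<bar>y\<bar> * \<bar>h n\<bar> powr (1 - p) < 1"
    by (rule order_tendstoD) simp
  then have "\<forall>\<^sub>F n in F. defect p y a (h n) = 0"
  proof eventually_elim
    case (elim n)
    have "y * h n \<le> \<bar>y\<bar> * (\<bar>h n\<bar> powr (1 - p) * \<bar>h n\<bar> powr p)"
      using p abs_ge_self[of "y * h n"] by (simp add: abs_mult flip: powr_add)
    also have "\<dots> \<le> \<bar>h n\<bar> powr p"
      using elim mult_right_mono[of "\<bar>y\<bar> * \<bar>h n\<bar> powr (1 - p)" 1 "\<bar>h n\<bar> powr p"] by (simp add: mult.assoc)
    finally show ?case using True p by (auto simp: defect_def min_def field_simps)
  qed
  then show ?thesis by (rule tendsto_eventually)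
next
  case False
  let ?D = "\<lambda>k. (\<bar>a + k\<bar> powr p - \<bar>a\<bar> powr p - y * k) / k"
  have "((\<lambda>k. (\<bar>a + k\<bar> powr p - \<bar>a\<bar> powr p) / k - y) \<longlongrightarrow> 0) (at 0)"
    using DERIV_abs_powr[OF False, of p] y[OF False] by (simp add: DERIV_def LIM_zero_iff)
  then have "(?D \<longlongrightarrow> 0) (at 0)"
    by (rule Lim_transform_eventually) (auto simp: eventually_at_filter field_simps)
  \<comment> \<open>Since \<open>?D 0 = 0\<close> by the convention for division by zero, the
    punctured limit becomes continuity, and indices with \<open>h n = 0\<close> need no separate
    treatment.\<close>
  then have "isCont ?D 0" by (simp add: isCont_def)
  then have "((\<lambda>n. ?D (h n)) \<longlongrightarrow> 0) F"
    using h isCont_tendsto_compose by fastforce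
  then show ?thesis
  proof (rule Lim_null_comparison[rotated, OF tendsto_rabs_zero])
    have "\<bar>min 0 (z / \<bar>k\<bar>)\<bar> \<le> \<bar>z / k\<bar>" for z k :: real
      using abs_divide[of z "\<bar>k\<bar>"] by (simp add: min_def)
    then show "\<forall>\<^sub>F n in F. norm (defect p y a (h n)) \<le> \<bar>?D (h n)\<bar>"
      unfolding defect_def real_norm_def by (intro always_eventually allI)
  qed
qed

section \<open>Lebesgue spaces over sets of finite measure\<close>

text \<open>Constants are integrable and t^p \<le> 1 + t^s for t \<ge> 0. Exponents below 1 are
  included, which makes the functional finite.\<close>

lemma (in finite_measure) integrable_abs_powr_le:
  fixes u :: "'a \<Rightarrow> real"
  assumes u: "u \<in> borel_measurable M" "integrable M (\<lambda>x. \<bar>u x\<bar> powr s)" and p: "0 \<le> p" "p \<le> s"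
  shows "integrable M (\<lambda>x. \<bar>u x\<bar> powr p)"
proof (rule Bochner_Integration.integrable_bound[where f = "\<lambda>x. 1 + \<bar>u x\<bar> powr s"])
  have "\<bar>a\<bar> powr p \<le> 1 + \<bar>a\<bar> powr s" for a :: real
  proof (cases "\<bar>a\<bar> \<le> 1")
    case True
    then show ?thesis using p powr_le1[of p "\<bar>a\<bar>"] by (simp add: add_increasing2)
  next
    case False
    then have "\<bar>a\<bar> powr p \<le> \<bar>a\<bar> powr s" using p by (intro powr_mono) auto
    then show ?thesis by simp
  qed
  then show "AE x in M. norm (\<bar>u x\<bar> powr p) \<le> norm (1 + \<bar>u x\<bar> powr s)"
    by simp
  show "integrable M (\<lambda>x. 1 + \<bar>u x\<bar> powr s)"
    using u(2) by (intro Bochner_Integration.integrable_add integrable_const)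
  show "(\<lambda>x. \<bar>u x\<bar> powr p) \<in> borel_measurable M"
    using u(1) by measurable
qed

lemma Lebesgue_space_mono:
  assumes "\<Omega> \<in> lmeasurable" "u \<in> Lebesgue_space \<Omega> s" "0 \<le> p" "p \<le> s"
  shows "u \<in> Lebesgue_space \<Omega> p"
  using finite_measure.integrable_abs_powr_le[OF finite_measure_lebesgue_on[OF assms(1)] _ _ assms(3,4)]
    assms(2) by (simp add: Lebesgue_space_def)

lemma integrable_Lebesgue_space:
  assumes "\<Omega> \<in> lmeasurable" "u \<in> Lebesgue_space \<Omega> s" "1 \<le> s"
  shows "integrable (lebesgue_on \<Omega>) u"
proof -
  have "u \<in> Lebesgue_space \<Omega> 1" by (rule Lebesgue_space_mono[OF assms(1,2)]) (use assms(3) in auto)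
  then show ?thesis
    using integrable_abs_iff[of u "lebesgue_on \<Omega>"] by (simp add: Lebesgue_space_def)
qed

text \<open>The sum is formed in L^1, where integrability is additive, and the exponent is then
  lowered from 1 to \<open>p\<close>.\<close>

lemma integrable_abs_powr_add:
  assumes \<Omega>: "\<Omega> \<in> lmeasurable" and u: "u \<in> Lebesgue_space \<Omega> s" and h: "h \<in> Lebesgue_space \<Omega> s"
    and "1 \<le> s" "0 \<le> p" "p \<le> 1"
  shows "integrable (lebesgue_on \<Omega>) (\<lambda>x. \<bar>u x + h x\<bar> powr p)"
proof -
  interpret finite_measure "lebesgue_on \<Omega>" by (rule finite_measure_lebesgue_on[OF \<Omega>])
  have "integrable (lebesgue_on \<Omega>) (\<lambda>x. u x + h x)"
    using assms by (intro Bochner_Integration.integrable_add integrable_Lebesgue_space)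
  then have "(\<lambda>x. u x + h x) \<in> borel_measurable (lebesgue_on \<Omega>)"
      "integrable (lebesgue_on \<Omega>) (\<lambda>x. \<bar>u x + h x\<bar> powr 1)"
    by (simp_all add: borel_measurable_integrable)
  then show ?thesis
    by (rule integrable_abs_powr_le[OF _ _ assms(5,6)])
qed

lemma Lebesgue_norm_nonneg: "0 \<le> Lebesgue_norm \<Omega> s u"
  by (simp add: Lebesgue_norm_def)

lemma Lebesgue_norm_powr:
  assumes "s \<noteq> 0"
  shows "Lebesgue_norm \<Omega> s u powr s = (\<integral>x. \<bar>u x\<bar> powr s \<partial>lebesgue_on \<Omega>)"
  using assms by (simp add: Lebesgue_norm_def powr_powr)

lemma Lebesgue_norm_eq_0_iff:
  assumes "u \<in> Lebesgue_space \<Omega> s"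
  shows "Lebesgue_norm \<Omega> s u = 0 \<longleftrightarrow> (AE x in lebesgue_on \<Omega>. u x = 0)"
  using assms integral_nonneg_eq_0_iff_AE[of "lebesgue_on \<Omega>" "\<lambda>x. \<bar>u x\<bar> powr s"]
  by (auto simp: Lebesgue_norm_def Lebesgue_space_def)

text \<open>The usual epsilon-delta form of the filter: as the norm is nonnegative, a neighbourhood
  of 0 may be replaced by the one-sided condition \<open>< d\<close>.\<close>

lemma eventually_nonzero_to_zero:
  "eventually P (nonzero_to_zero \<Omega> s) \<longleftrightarrow>
    (\<exists>d>0. \<forall>h\<in>Lebesgue_space \<Omega> s.
      \<not> (AE x in lebesgue_on \<Omega>. h x = 0) \<longrightarrow> Lebesgue_norm \<Omega> s h < d \<longrightarrow> P h)"
  (is "?L \<longleftrightarrow> ?R")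
proof
  assume ?L
  then obtain Q where Q: "eventually Q (nhds 0)"
    and P: "\<And>h. Q (Lebesgue_norm \<Omega> s h) \<Longrightarrow> h \<in> Lebesgue_space \<Omega> s \<Longrightarrow>
      \<not> (AE x in lebesgue_on \<Omega>. h x = 0) \<Longrightarrow> P h"
    by (auto simp: nonzero_to_zero_def eventually_inf_principal eventually_filtercomap)
  from Q obtain d where "d > 0" "\<And>t. \<bar>t\<bar> < d \<Longrightarrow> Q t"
    by (auto simp: eventually_nhds_metric)
  then show ?R
    using P Lebesgue_norm_nonneg[of \<Omega> s] by (intro exI[of _ d]) auto
next
  assume ?R
  then obtain d where d: "d > 0" "\<And>h. h \<in> Lebesgue_space \<Omega> s \<Longrightarrow>
      \<not> (AE x in lebesgue_on \<Omega>. h x = 0) \<Longrightarrow> Lebesgue_norm \<Omega> s h < d \<Longrightarrow> P h"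
    by auto
  have "eventually (\<lambda>t. t < d) (nhds 0)"
    using d(1) eventually_nhds_in_open[of "{..<d}" 0] by simp
  then show ?L
    using d(2) by (auto simp: nonzero_to_zero_def eventually_inf_principal eventually_filtercomap)
qed

context
  fixes \<Omega> :: "'a::euclidean_space set" and p s r :: real and u \<eta> :: "'a \<Rightarrow> real"
  assumes \<Omega>: "\<Omega> \<in> lmeasurable" and p: "0 < p" "p < 1"
    and sr: "1 < s" "1 < r" "1 / s + 1 / r = 1"
    and u: "u \<in> Lebesgue_space \<Omega> s" and \<eta>: "\<eta> \<in> Lebesgue_space \<Omega> r"
begin

lemma measurable_u [measurable]: "u \<in> borel_measurable (lebesgue_on \<Omega>)"
  and measurable_\<eta> [measurable]: "\<eta> \<in> borel_measurable (lebesgue_on \<Omega>)"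
  using u \<eta> by (auto simp: Lebesgue_space_def)

lemma integrable_abs_powr: "integrable (lebesgue_on \<Omega>) (\<lambda>x. \<bar>u x\<bar> powr p)"
  using Lebesgue_space_mono[OF \<Omega> u, of p] p sr by (auto simp: Lebesgue_space_def)

section \<open>The pointwise formula makes \<eta> a subgradient\<close>

context
  assumes eq: "AE x in lebesgue_on \<Omega>. u x \<noteq> 0 \<longrightarrow> \<eta> x = p * \<bar>u x\<bar> powr (p - 2) * u x"
begin

text \<open>The quantifier over \<open>k\<close> stands inside \<open>AE\<close>: the exceptional
  null set depends only on \<open>u\<close> and \<open>\<eta>\<close>, so \<open>k\<close> may be
  replaced by \<open>h x\<close> for any function \<open>h\<close>.\<close>

lemma defect_powr_le:
  "AE x in lebesgue_on \<Omega>. \<forall>k. \<bar>defect p (\<eta> x) (u x) k\<bar> powr r \<le> (1 / p + 1) powr r * \<bar>\<eta> x\<bar> powr r"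
  using eq
proof eventually_elim
  case (elim x)
  then have "\<bar>defect p (\<eta> x) (u x) k\<bar> powr r \<le> ((1 / p + 1) * \<bar>\<eta> x\<bar>) powr r" for k
    using p sr by (intro powr_mono2 abs_defect_le) auto
  then show ?case using p by (simp add: powr_mult)
qed

lemma defect_in_Lebesgue_space:
  assumes "h \<in> Lebesgue_space \<Omega> s"
  shows "(\<lambda>x. defect p (\<eta> x) (u x) (h x)) \<in> Lebesgue_space \<Omega> r"
proof -
  have [measurable]: "h \<in> borel_measurable (lebesgue_on \<Omega>)"
    using assms by (simp add: Lebesgue_space_def)
  have "integrable (lebesgue_on \<Omega>) (\<lambda>x. \<bar>defect p (\<eta> x) (u x) (h x)\<bar> powr r)"
    by (rule Bochner_Integration.integrable_bound
        [where f = "\<lambda>x. (1 / p + 1) powr r * \<bar>\<eta> x\<bar> powr r"])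
      (use \<eta> defect_powr_le in \<open>auto simp: Lebesgue_space_def\<close>)
  then show ?thesis by (simp add: Lebesgue_space_def)
qed

text \<open>Integrate \<open>defect_mult_le\<close> and apply Hoelder's inequality to the defect in
  L^r and \<open>h\<close> in L^s. Dividing by the norm of \<open>h\<close> bounds the difference
  quotient below by minus the norm of the defect.\<close>

lemma q_functional_increment_ge:
  assumes h: "h \<in> Lebesgue_space \<Omega> s"
  shows "- (Lebesgue_norm \<Omega> r (\<lambda>x. defect p (\<eta> x) (u x) (h x)) * Lebesgue_norm \<Omega> s h)
    \<le> q_functional \<Omega> p (\<lambda>x. u x + h x) - q_functional \<Omega> p u - (\<integral>x. \<eta> x * h x \<partial>lebesgue_on \<Omega>)"
proof -
  let ?M = "lebesgue_on \<Omega>" and ?d = "\<lambda>x. defect p (\<eta> x) (u x) (h x)"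
  note Holder = Holder_inequality[of r s _ "lebesgue_on \<Omega>" h]
  have rs: "1 / r + 1 / s = 1" using sr by simp
  have ints: "integrable ?M (\<lambda>x. \<bar>u x + h x\<bar> powr p)" "integrable ?M (\<lambda>x. \<eta> x * h x)"
      "integrable ?M (\<lambda>x. ?d x * h x)"
    using integrable_abs_powr_add[OF \<Omega> u h] p sr
      Holder(1)[of \<eta>] Holder(1)[of ?d] rs h \<eta> defect_in_Lebesgue_space[OF h]
    by (auto simp: Lebesgue_space_def)
  have "(\<integral>x. \<bar>?d x * h x\<bar> \<partial>?M) \<le> Lebesgue_norm \<Omega> r ?d * Lebesgue_norm \<Omega> s h"
    using Holder(2)[of ?d] sr rs h defect_in_Lebesgue_space[OF h]
    by (auto simp: Lebesgue_space_def Lebesgue_norm_def)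
  then have "- (Lebesgue_norm \<Omega> r ?d * Lebesgue_norm \<Omega> s h) \<le> (\<integral>x. - \<bar>?d x * h x\<bar> \<partial>?M)"
    by simp
  also have "\<dots> \<le> (\<integral>x. \<bar>u x + h x\<bar> powr p - \<bar>u x\<bar> powr p - \<eta> x * h x \<partial>?M)"
  proof (rule integral_mono)
    have "- \<bar>?d x * h x\<bar> = ?d x * \<bar>h x\<bar>" for x
      by (simp add: abs_mult defect_def)
    then show "- \<bar>?d x * h x\<bar> \<le> \<bar>u x + h x\<bar> powr p - \<bar>u x\<bar> powr p - \<eta> x * h x" for x
      by (simp only: defect_mult_le)
  qed (use ints integrable_abs_powr in auto)
  also have "\<dots> = q_functional \<Omega> p (\<lambda>x. u x + h x) - q_functional \<Omega> p u - (\<integral>x. \<eta> x * h x \<partial>?M)"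
    using ints integrable_abs_powr by (simp add: q_functional_def)
  finally show ?thesis .
qed

text \<open>Dominated convergence: \<open>defect_tendsto_0\<close> gives the pointwise limit,
  \<open>defect_powr_le\<close> the majorant.\<close>

lemma Lebesgue_norm_defect_tendsto_0:
  assumes h: "\<And>n. h n \<in> Lebesgue_space \<Omega> s"
    and lim: "AE x in lebesgue_on \<Omega>. (\<lambda>n. h n x) \<longlonglongrightarrow> 0"
  shows "(\<lambda>n. Lebesgue_norm \<Omega> r (\<lambda>x. defect p (\<eta> x) (u x) (h n x))) \<longlonglongrightarrow> 0"
proof -
  let ?d = "\<lambda>n x. defect p (\<eta> x) (u x) (h n x)"
  have [measurable]: "h n \<in> borel_measurable (lebesgue_on \<Omega>)" for n
    using h by (simp add: Lebesgue_space_def)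
  have "(\<lambda>n. \<integral>x. \<bar>?d n x\<bar> powr r \<partial>lebesgue_on \<Omega>) \<longlonglongrightarrow> (\<integral>x. 0 \<partial>lebesgue_on \<Omega>)"
  proof (rule integral_dominated_convergence[where w = "\<lambda>x. (1 / p + 1) powr r * \<bar>\<eta> x\<bar> powr r"])
    show "AE x in lebesgue_on \<Omega>. (\<lambda>n. \<bar>?d n x\<bar> powr r) \<longlonglongrightarrow> 0"
      using lim eq
    proof eventually_elim
      case (elim x)
      then have "(\<lambda>n. ?d n x) \<longlonglongrightarrow> 0" using p by (intro defect_tendsto_0) auto
      then show ?case using sr by (auto intro!: tendsto_eq_intros)
    qed
    show "AE x in lebesgue_on \<Omega>. norm (\<bar>?d n x\<bar> powr r) \<le> (1 / p + 1) powr r * \<bar>\<eta> x\<bar> powr r" for n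
      using defect_powr_le by eventually_elim simp
  qed (use \<eta> in \<open>auto simp: Lebesgue_space_def\<close>)
  then show ?thesis
    using sr unfolding Lebesgue_norm_def
    by (intro tendsto_zero_powrI[where b = "1 / r"]) auto
qed

lemma in_frechet_subdifferential: "\<eta> \<in> frechet_subdifferential \<Omega> s r (q_functional \<Omega> p) u"
proof -
  define Q where "Q h = (q_functional \<Omega> p (\<lambda>x. u x + h x) - q_functional \<Omega> p u
    - (\<integral>x. \<eta> x * h x \<partial>lebesgue_on \<Omega>)) / Lebesgue_norm \<Omega> s h" for h
  have ev: "eventually (\<lambda>h. y < Q h) (nonzero_to_zero \<Omega> s)" if "y < 0" for y
  proof (rule ccontr)
    assume "\<not> ?thesis"
    \<comment> \<open>If the quotient does not eventually exceed \<open>y\<close>, the radii 1/(n+1)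
      produce a null sequence of nonzero directions along which it stays at or below
      \<open>y\<close>.\<close>
    then have "\<exists>h\<in>Lebesgue_space \<Omega> s. \<not> (AE x in lebesgue_on \<Omega>. h x = 0) \<and>
        Lebesgue_norm \<Omega> s h < inverse (Suc n) \<and> Q h \<le> y" for n
      unfolding eventually_nonzero_to_zero by (force simp: not_less)
    then obtain h where h: "\<And>n. h n \<in> Lebesgue_space \<Omega> s"
        "\<And>n. \<not> (AE x in lebesgue_on \<Omega>. h n x = 0)"
        "\<And>n. Lebesgue_norm \<Omega> s (h n) < inverse (Suc n)" "\<And>n. Q (h n) \<le> y"
      by metis
    have "(\<lambda>n. Lebesgue_norm \<Omega> s (h n)) \<longlonglongrightarrow> 0"
      by (rule tendsto_sandwich[OF _ _ tendsto_const LIMSEQ_inverse_real_of_nat])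
        (use h(3) in \<open>auto intro!: always_eventually less_imp_le simp: Lebesgue_norm_nonneg\<close>)
    then have "(\<lambda>n. Lebesgue_norm \<Omega> s (h n) powr s) \<longlonglongrightarrow> 0"
      using sr by (intro tendsto_zero_powrI[where b = s]) (auto simp: Lebesgue_norm_nonneg)
    \<comment> \<open>The functions |h n|^s tend to 0 in L^1, hence almost everywhere along a
      subsequence. Taking s-th roots carries this over to \<open>h (k n)\<close>.\<close>
    then obtain k :: "nat \<Rightarrow> nat" where
      k: "AE x in lebesgue_on \<Omega>. (\<lambda>n. \<bar>h (k n) x\<bar> powr s) \<longlonglongrightarrow> 0"
      using tendsto_L1_AE_subseq[of "lebesgue_on \<Omega>" "\<lambda>n x. \<bar>h n x\<bar> powr s"] h(1) sr
      by (auto simp: Lebesgue_norm_powr Lebesgue_space_def)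
    have "AE x in lebesgue_on \<Omega>. (\<lambda>n. h (k n) x) \<longlonglongrightarrow> 0"
      using k
    proof eventually_elim
      case (elim x)
      then have "(\<lambda>n. (\<bar>h (k n) x\<bar> powr s) powr (1 / s)) \<longlonglongrightarrow> 0"
        using sr by (intro tendsto_zero_powrI[where f = "\<lambda>n. \<bar>h (k n) x\<bar> powr s" and b = "1 / s"]) auto
      then show ?case using sr by (simp add: powr_powr tendsto_rabs_zero_iff)
    qed
    then have "(\<lambda>n. - Lebesgue_norm \<Omega> r (\<lambda>x. defect p (\<eta> x) (u x) (h (k n) x))) \<longlonglongrightarrow> - 0"
      by (intro tendsto_minus Lebesgue_norm_defect_tendsto_0 h)
    moreover have "- Lebesgue_norm \<Omega> r (\<lambda>x. defect p (\<eta> x) (u x) (h (k n) x)) \<le> y" for n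
    proof -
      have "Lebesgue_norm \<Omega> s (h (k n)) > 0"
        using h(2)[of "k n"] Lebesgue_norm_eq_0_iff[OF h(1)[of "k n"]]
          Lebesgue_norm_nonneg[of \<Omega> s "h (k n)"] by linarith
      then have "- Lebesgue_norm \<Omega> r (\<lambda>x. defect p (\<eta> x) (u x) (h (k n) x)) \<le> Q (h (k n))"
        using q_functional_increment_ge[OF h(1)[of "k n"]] by (simp add: Q_def pos_le_divide_eq)
      then show ?thesis using h(4)[of "k n"] by simp
    qed
    \<comment> \<open>The lower bounds for the quotient tend to 0 but never exceed \<open>y\<close>,
      contradicting y < 0.\<close>
    ultimately have "- 0 \<le> y" by (intro tendsto_upperbound) auto
    then show False using \<open>y < 0\<close> by simp
  qed
  have "0 \<le> Liminf (nonzero_to_zero \<Omega> s) (\<lambda>h. ereal (Q h))"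
    unfolding le_Liminf_iff
  proof safe
    fix y :: ereal assume "y < 0"
    then show "eventually (\<lambda>h. y < ereal (Q h)) (nonzero_to_zero \<Omega> s)"
      using ev by (cases y) auto
  qed
  then show ?thesis using \<eta> by (simp add: frechet_subdifferential_def Q_def)
qed

end

section \<open>Subgradients satisfy the pointwise formula\<close>

text \<open>On {|u| > c} the factor |u|^(p-1) is at most c^(p-1), so the difference quotients in a
  bounded direction supported there have a constant majorant, integrable because
  \<open>\<Omega>\<close> has finite measure.\<close>

lemma frechet_subdifferential_AE_eq_above:
  assumes sub: "\<eta> \<in> frechet_subdifferential \<Omega> s r (q_functional \<Omega> p) u" and c: "0 < c"
  shows "AE x in lebesgue_on \<Omega>. c < \<bar>u x\<bar> \<longrightarrow> \<eta> x = p * \<bar>u x\<bar> powr (p - 2) * u x"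
proof (rule ccontr)
  assume contra: "\<not> ?thesis"
  let ?M = "lebesgue_on \<Omega>"
  interpret finite_measure ?M by (rule finite_measure_lebesgue_on[OF \<Omega>])
  define v where "v x = p * \<bar>u x\<bar> powr (p - 2) * u x" for x
  define w where "w x = (if c < \<bar>u x\<bar> then sgn (\<eta> x - v x) else 0)" for x
  define h where "h n x = w x / real (Suc n)" for n x
  have [measurable]: "v \<in> borel_measurable ?M" unfolding v_def by measurable
  have [measurable]: "w \<in> borel_measurable ?M" unfolding w_def sgn_real_def by measurable
  have [measurable]: "h n \<in> borel_measurable ?M" for n unfolding h_def by measurable
  have w1: "\<bar>w x\<bar> \<le> 1" for x by (simp add: w_def sgn_real_def)
  have wL: "w \<in> Lebesgue_space \<Omega> s"
  proof -
    have "integrable ?M (\<lambda>x. \<bar>w x\<bar> powr s)"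
      by (rule integrable_const_bound[where B = 1]) (use w1 sr in \<open>auto intro!: powr_le1\<close>)
    then show ?thesis by (simp add: Lebesgue_space_def)
  qed
  have hL: "h n \<in> Lebesgue_space \<Omega> s" for n
    using wL sr by (simp add: Lebesgue_space_def h_def powr_divide)
  have Nw: "Lebesgue_norm \<Omega> s w > 0"
  proof -
    \<comment> \<open>Where |u| > c, \<open>w\<close> vanishes exactly when \<open>\<eta>\<close>
      agrees with \<open>v\<close>. Failure of the claim thus makes \<open>w\<close> an admissible,
      nonzero direction.\<close>
    have "\<not> (AE x in ?M. w x = 0)"
      using contra by (rule contrapos_nn) (auto elim!: eventually_mono simp: w_def v_def sgn_zero_iff)
    then show ?thesis
      using Lebesgue_norm_eq_0_iff[OF wL] Lebesgue_norm_nonneg[of \<Omega> s w] by linarith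
  qed
  have Nh: "Lebesgue_norm \<Omega> s (h n) = Lebesgue_norm \<Omega> s w / real (Suc n)" for n
    using sr by (simp add: Lebesgue_norm_def h_def powr_divide powr_powr)
  have lim_h: "filterlim h (nonzero_to_zero \<Omega> s) sequentially"
    unfolding filterlim_iff
  proof safe
    fix P assume "eventually P (nonzero_to_zero \<Omega> s)"
    then obtain d where d: "d > 0" "\<And>k. k \<in> Lebesgue_space \<Omega> s \<Longrightarrow>
        \<not> (AE x in ?M. k x = 0) \<Longrightarrow> Lebesgue_norm \<Omega> s k < d \<Longrightarrow> P k"
      by (auto simp: eventually_nonzero_to_zero)
    have "(\<lambda>n. Lebesgue_norm \<Omega> s w / real (Suc n)) \<longlonglongrightarrow> 0"
      by (rule LIMSEQ_Suc[OF lim_const_over_n])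
    then have "\<forall>\<^sub>F n in sequentially. Lebesgue_norm \<Omega> s w / real (Suc n) < d"
      using d(1) by (rule order_tendstoD)
    then show "\<forall>\<^sub>F n in sequentially. P (h n)"
    proof eventually_elim
      case (elim n)
      have "\<not> (AE x in ?M. h n x = 0)"
        using Nw Nh[of n] Lebesgue_norm_eq_0_iff[OF hL[of n]] by auto
      then show ?case using d(2)[OF hL[of n]] elim Nh[of n] by simp
    qed
  qed
  have v_abs: "\<bar>v x\<bar> \<le> p * c powr (p - 1)" if "c < \<bar>u x\<bar>" for x
  proof -
    have "\<bar>v x\<bar> = p * \<bar>u x\<bar> powr (p - 1)"
      using that c p powr_add[of "\<bar>u x\<bar>" "p - 2" 1] by (simp add: v_def abs_mult)
    then show ?thesis using that c p by (simp add: powr_mono2')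
  qed
  have int_\<eta>w: "integrable ?M (\<lambda>x. \<eta> x * w x)"
    using Holder_inequality(1)[of r s \<eta> ?M w] sr \<eta> wL by (auto simp: Lebesgue_space_def)
  have int_vw: "integrable ?M (\<lambda>x. v x * w x)"
  proof (rule integrable_const_bound[where B = "p * c powr (p - 1)"])
    have "\<bar>v x * w x\<bar> \<le> p * c powr (p - 1)" for x
      using v_abs[of x] mult_mono[of "\<bar>v x\<bar>" "p * c powr (p - 1)" "\<bar>w x\<bar>" 1] w1[of x] p
      by (cases "c < \<bar>u x\<bar>") (auto simp: abs_mult w_def)
    then show "AE x in ?M. norm (v x * w x) \<le> p * c powr (p - 1)" by simp
  qed simp
  \<comment> \<open>The difference quotient of |t|^p at \<open>u x\<close> in direction
    \<open>w x\<close> with step 1/(n+1). Its expected limit is \<open>v x * w x\<close>.\<close>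
  define D where "D n x = real (Suc n) * (\<bar>u x + h n x\<bar> powr p - \<bar>u x\<bar> powr p)" for n x
  have int_D: "(\<integral>x. D n x \<partial>?M) =
      real (Suc n) * (q_functional \<Omega> p (\<lambda>x. u x + h n x) - q_functional \<Omega> p u)" for n
    using integrable_abs_powr_add[OF \<Omega> u hL] integrable_abs_powr p sr
    by (simp add: D_def q_functional_def del: of_nat_Suc)
  have lim_D: "(\<lambda>n. \<integral>x. D n x \<partial>?M) \<longlonglongrightarrow> (\<integral>x. v x * w x \<partial>?M)"
  proof (rule integral_dominated_convergence[where w = "\<lambda>x. c powr (p - 1)"])
    have "(\<lambda>n. D n x) \<longlonglongrightarrow> v x * w x" for x
    proof (cases "w x = 0")
      case True
      then show ?thesis by (simp add: D_def h_def)
    next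
      case False
      then have ux: "u x \<noteq> 0" using c by (auto simp: w_def split: if_splits)
      have "(\<lambda>n. h n x) \<longlonglongrightarrow> 0" unfolding h_def by (rule LIMSEQ_Suc[OF lim_const_over_n])
      \<comment> \<open>The increments tend to 0 through nonzero values, so the derivative applies;
        \<open>D n x\<close> is the quotient by \<open>h n x\<close> times
        \<open>w x\<close>.\<close>
      then have "filterlim (\<lambda>n. h n x) (at 0) sequentially"
        using False by (intro filterlim_atI) (auto simp: h_def)
      then have "(\<lambda>n. (\<bar>u x + h n x\<bar> powr p - \<bar>u x\<bar> powr p) / h n x) \<longlonglongrightarrow> v x"
        using DERIV_abs_powr[OF ux, of p] unfolding DERIV_def v_def[symmetric]
        by (rule filterlim_compose[rotated])
      then have "(\<lambda>n. (\<bar>u x + h n x\<bar> powr p - \<bar>u x\<bar> powr p) / h n x * w x) \<longlonglongrightarrow> v x * w x"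
        by (rule tendsto_mult_right)
      then show ?thesis using False by (simp add: D_def h_def mult.commute del: of_nat_Suc)
    qed
    then show "AE x in ?M. (\<lambda>n. D n x) \<longlonglongrightarrow> v x * w x" by simp
    have "\<bar>D n x\<bar> \<le> c powr (p - 1)" for n x
    proof (cases "c < \<bar>u x\<bar>")
      case True
      then have "\<bar>D n x\<bar> \<le> real (Suc n) * (\<bar>u x\<bar> powr (p - 1) * \<bar>h n x\<bar>)"
        using c p abs_powr_diff_le[of "u x" p "h n x"] by (auto simp: D_def abs_mult)
      also have "\<dots> = \<bar>u x\<bar> powr (p - 1) * \<bar>w x\<bar>"
        by (simp add: h_def)
      also have "\<dots> \<le> c powr (p - 1) * 1"
        using True c p w1 by (intro mult_mono powr_mono2') auto
      finally show ?thesis by simp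
    qed (simp add: D_def h_def w_def)
    then show "AE x in ?M. norm (D n x) \<le> c powr (p - 1)" for n by simp
  qed (auto simp: D_def)
  define Q where "Q k = (q_functional \<Omega> p (\<lambda>x. u x + k x) - q_functional \<Omega> p u
    - (\<integral>x. \<eta> x * k x \<partial>?M)) / Lebesgue_norm \<Omega> s k" for k
  have "0 \<le> Liminf (nonzero_to_zero \<Omega> s) (\<lambda>h. ereal (Q h))"
    using sub by (simp add: frechet_subdifferential_def Q_def)
  then have ev: "eventually (\<lambda>n. y < Q (h n)) sequentially" if "y < 0" for y
    using that lim_h unfolding le_Liminf_iff filterlim_iff by (auto dest!: spec[of _ "ereal y"])
  \<comment> \<open>The step 1/(n+1) in the norm of \<open>h n\<close> cancels against the one in
    the numerator.\<close>
  have Q_h: "Q (h n) = ((\<integral>x. D n x \<partial>?M) - (\<integral>x. \<eta> x * w x \<partial>?M)) / Lebesgue_norm \<Omega> s w" for n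
  proof -
    have "(A - B / m) / (N / m) = (m * A - B) / N" if "m > 0" for A B m N :: real
      using that by (cases "N = 0") (auto simp: field_simps)
    moreover have "(\<integral>x. \<eta> x * h n x \<partial>?M) = (\<integral>x. \<eta> x * w x \<partial>?M) / real (Suc n)"
      by (simp add: h_def del: of_nat_Suc)
    ultimately show ?thesis
      unfolding Q_def Nh int_D by (simp del: of_nat_Suc)
  qed
  have "(\<lambda>n. Q (h n)) \<longlonglongrightarrow>
      ((\<integral>x. v x * w x \<partial>?M) - (\<integral>x. \<eta> x * w x \<partial>?M)) / Lebesgue_norm \<Omega> s w"
    unfolding Q_h using Nw by (intro tendsto_intros lim_D) simp
  \<comment> \<open>The sequence eventually exceeds every negative \<open>y\<close>, so its limit is
    at least every negative \<open>y\<close> and hence nonnegative.\<close>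
  then have ge: "y \<le> ((\<integral>x. v x * w x \<partial>?M) - (\<integral>x. \<eta> x * w x \<partial>?M)) / Lebesgue_norm \<Omega> s w"
    if "y < 0" for y
    using ev[OF that] by (intro tendsto_lowerbound) (auto elim: eventually_mono)
  have "0 \<le> ((\<integral>x. v x * w x \<partial>?M) - (\<integral>x. \<eta> x * w x \<partial>?M)) / Lebesgue_norm \<Omega> s w"
    by (rule dense_le) (rule ge)
  then have le: "(\<integral>x. \<eta> x * w x - v x * w x \<partial>?M) \<le> 0"
    using Nw int_\<eta>w int_vw by (simp add: zero_le_divide_iff)
  \<comment> \<open>By the choice of \<open>w\<close> as a sign, the integrand is |\<eta> - v| on
    {|u| > c} and 0 elsewhere. Its integral is also at most 0, so it vanishes almost
    everywhere.\<close>
  have nonneg: "0 \<le> \<eta> x * w x - v x * w x" for x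
    by (auto simp: w_def sgn_real_def)
  have "0 \<le> (\<integral>x. \<eta> x * w x - v x * w x \<partial>?M)"
    by (intro Bochner_Integration.integral_nonneg nonneg)
  with le have "(\<integral>x. \<eta> x * w x - v x * w x \<partial>?M) = 0" by simp
  then have "AE x in ?M. \<eta> x * w x - v x * w x = 0"
    using int_\<eta>w int_vw nonneg by (subst (asm) integral_nonneg_eq_0_iff_AE) auto
  then have ?thesis
    by eventually_elim (auto simp: w_def v_def sgn_real_def split: if_splits)
  with contra show False ..
qed

text \<open>The set {u \<noteq> 0} is the countable union of the sets {|u| > 1/(n+1)}, so the null
  sets for the individual cut-offs can be united.\<close>

lemma frechet_subdifferential_AE_eq:
  assumes sub: "\<eta> \<in> frechet_subdifferential \<Omega> s r (q_functional \<Omega> p) u"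
  shows "AE x in lebesgue_on \<Omega>. u x \<noteq> 0 \<longrightarrow> \<eta> x = p * \<bar>u x\<bar> powr (p - 2) * u x"
proof -
  have "AE x in lebesgue_on \<Omega>. \<forall>n. inverse (real (Suc n)) < \<bar>u x\<bar> \<longrightarrow>
      \<eta> x = p * \<bar>u x\<bar> powr (p - 2) * u x"
    unfolding AE_all_countable using frechet_subdifferential_AE_eq_above[OF sub] by simp
  then show ?thesis
  proof eventually_elim
    case (elim x)
    then show ?case using reals_Archimedean[of "\<bar>u x\<bar>"] by auto
  qed
qed

text \<open>On {u \<noteq> 0} the formula gives |u|^(p-1) = |\<eta>| / p, and \<open>\<eta>\<close>
  lies in L^r. The contrapositive is the emptiness claim.\<close>

lemma abs_powr_in_Lebesgue_space:
  assumes eq: "AE x in lebesgue_on \<Omega>. u x \<noteq> 0 \<longrightarrow> \<eta> x = p * \<bar>u x\<bar> powr (p - 2) * u x"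
  shows "(\<lambda>x. \<bar>u x\<bar> powr (p - 1) * indicator {x \<in> \<Omega>. u x \<noteq> 0} x) \<in> Lebesgue_space \<Omega> r" (is "?f \<in> _")
proof -
  have [measurable]: "{x \<in> \<Omega>. u x \<noteq> 0} \<in> sets (lebesgue_on \<Omega>)"
    using measurable_sets[OF measurable_u, of "- {0}"] by (simp add: vimage_def Int_def conj_commute)
  have "integrable (lebesgue_on \<Omega>) (\<lambda>x. \<bar>?f x\<bar> powr r)"
  proof (rule Bochner_Integration.integrable_bound[where f = "\<lambda>x. \<bar>\<eta> x\<bar> powr r / p powr r"])
    show "AE x in lebesgue_on \<Omega>. norm (\<bar>?f x\<bar> powr r) \<le> norm (\<bar>\<eta> x\<bar> powr r / p powr r)"
      using eq
    proof eventually_elim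
      case (elim x)
      show ?case
      proof (cases "u x = 0")
        case False
        then have "\<bar>\<eta> x\<bar> = p * \<bar>u x\<bar> powr (p - 1)"
          using elim p powr_add[of "\<bar>u x\<bar>" "p - 2" 1] by (simp add: abs_mult)
        then show ?thesis using p by (simp add: powr_mult indicator_def)
      qed simp
    qed
  qed (use \<eta> in \<open>auto simp: Lebesgue_space_def\<close>)
  then show ?thesis by (simp add: Lebesgue_space_def)
qed

end

theorem theorem4p4:
  fixes \<Omega> :: "(real ^ 'd) set" and p s r :: real and u :: "real ^ 'd \<Rightarrow> real"
  assumes "\<Omega> \<in> sets lebesgue" and "0 < emeasure lebesgue \<Omega>" and "emeasure lebesgue \<Omega> < \<infinity>"
    and "0 < p" and "p < 1"
    and "1 < s" and "1 < r" and "1 / s + 1 / r = 1"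
    and "u \<in> Lebesgue_space \<Omega> s"
  shows "frechet_subdifferential \<Omega> s r (q_functional \<Omega> p) u =
      {\<eta> \<in> Lebesgue_space \<Omega> r.
        AE x in lebesgue_on \<Omega>. u x \<noteq> 0 \<longrightarrow> \<eta> x = p * \<bar>u x\<bar> powr (p - 2) * u x} \<and>
    ((\<lambda>x. \<bar>u x\<bar> powr (p - 1) * indicator {x \<in> \<Omega>. u x \<noteq> 0} x) \<notin> Lebesgue_space \<Omega> r \<longrightarrow>
      {\<eta> \<in> Lebesgue_space \<Omega> r.
        AE x in lebesgue_on \<Omega>. u x \<noteq> 0 \<longrightarrow> \<eta> x = p * \<bar>u x\<bar> powr (p - 2) * u x} = {})"
proof -
  have \<Omega>: "\<Omega> \<in> lmeasurable" using assms by (simp add: fmeasurable_def)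
  have sub: "\<eta> \<in> Lebesgue_space \<Omega> r" if "\<eta> \<in> frechet_subdifferential \<Omega> s r (q_functional \<Omega> p) u" for \<eta>
    using that by (simp add: frechet_subdifferential_def)
  show ?thesis
    using in_frechet_subdifferential[OF \<Omega> assms(4-9)] sub
      frechet_subdifferential_AE_eq[OF \<Omega> assms(4-9) sub]
      abs_powr_in_Lebesgue_space[OF \<Omega> assms(4-9)]
    by blast
qed

end
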